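(* Let $\mathcal{M}$ be a rank $r$, uniform, not essentially oriented, realizable phased matroid on $[n]$. Then its realization space $\mathcal{R}(\mathcal{M})$ is homeomorphic to $\mathbb{R}_{>0}^{n-1}$.
   Context: $S^1=\{z\in\mathbb{C}:|z|=1\}$. For $z\in\mathbb{C}$, $\operatorname{ph}(z)=z/|z|$ if $z\neq0$ and $\operatorname{ph}(0)=0$. For a nonempty finite set $S\subseteq S^1\cup\{0\}$, the hypersum $\boxplus S$ is the set of all phases $\operatorname{ph}(\sum_{\alpha\in S}c_\alpha\alpha)$ with all $c_\alpha$ strictly positive reals. A rank $r$ phirotope on $[n]$ is a function $\varphi:[n]^r\to S^1\cup\{0\}$, not identically zero, which is alternating (swapping two arguments multiplies the value by $-1$; in particular it vanishes when two arguments coincide) and satisfies, for all $x_1,\dots,x_{r+1},y_1,\dots,y_{r-1}\in[n]$: $0\in\boxplus\{(-1)^k\varphi(x_1,\dots,\widehat{x_k},\dots,x_{r+1})\,\varphi(x_k,y_1,\dots,y_{r-1}):k=1,\dots,r+1\}$. A phased matroid is a set $\mathcal{M}=\{\alpha\varphi:\alpha\in S^1\}$ with $\varphi$ a phirotope; its elements are its phirotopes. $\mathcal{M}$ is uniform if $\varphi(\lambda)\neq0$ for every $r$-tuple $\lambda$ of distinct elements. For $A\in\mathbb{C}^{r\times n}$, $\varphi_A(\lambda_1,\dots,\lambda_r)=\operatorname{ph}\det(A_{\lambda_1}|\cdots|A_{\lambda_r})$ (columns of $A$). $A$ is a realization of $\mathcal{M}$ if $\varphi_A\in\mathcal{M}$;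 $\mathcal{M}$ is realizable if it has a realization. The realization space $\mathcal{R}(\mathcal{M})$ is the set of realizations of $\mathcal{M}$ (subspace topology from $\mathbb{C}^{r\times n}$) modulo the left action of $GL(r,\mathbb{C})$, with the quotient topology. For $\rho\in(S^1)^n$, the rephasing $\varphi^\rho(\lambda_1,\dots,\lambda_r)=\rho_{\lambda_1}\cdots\rho_{\lambda_r}\varphi(\lambda_1,\dots,\lambda_r)$. $\mathcal{M}$ is essentially oriented if there exist a phirotope $\varphi$ of $\mathcal{M}$ and $\rho\in(S^1)^n$ with $\varphi^\rho([n]^r)\subseteq\{-1,0,1\}$. *)

theory Defs
  imports "HOL-Analysis.Analysis" "Jordan_Normal_Form.Determinant"
begin

text \<open>
  The ground set \<open>[n]\<close> is \<open>{..<n}\<close>, in line with the 0-based column indices of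
  \<^typ>\<open>complex mat\<close>, and an element of \<open>[n]\<^sup>k\<close> is a list of length \<open>k\<close>.
  Functions on \<open>[n]\<^sup>r\<close> are extensional (\<open>undefined\<close> on all other lists), so that equality and
  membership in a phased matroid depend on their values on \<open>[n]\<^sup>r\<close> only.
\<close>

definition tuples :: "nat \<Rightarrow> nat \<Rightarrow> nat list set" where
  "tuples k n = {xs. length xs = k \<and> set xs \<subseteq> {..<n}}"

text \<open>On the complex numbers, \<open>sgn z\<close> is \<open>z / |z|\<close> for nonzero \<open>z\<close>, and \<open>sgn 0 = 0\<close>.\<close>

abbreviation ph :: "complex \<Rightarrow> complex" where
  "ph \<equiv> sgn"

abbreviation S1 :: "complex set" where
  "S1 \<equiv> sphere 0 1"

definition hypersum :: "complex set \<Rightarrow> complex set" where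
  "hypersum S = {ph (\<Sum>\<alpha>\<in>S. complex_of_real (c \<alpha>) * \<alpha>) | c. \<forall>\<alpha>\<in>S. 0 < c \<alpha>}"

definition remove_at :: "nat \<Rightarrow> 'a list \<Rightarrow> 'a list" where
  "remove_at k xs = take k xs @ drop (Suc k) xs"

definition alternating :: "nat \<Rightarrow> nat \<Rightarrow> (nat list \<Rightarrow> complex) \<Rightarrow> bool" where
  "alternating r n \<phi> \<longleftrightarrow>
     (\<forall>xs\<in>tuples r n. \<forall>i<r. \<forall>j<r. i \<noteq> j \<longrightarrow> \<phi> (xs[i := xs ! j, j := xs ! i]) = - \<phi> xs)"

text \<open>
  The position \<open>k\<close> below is 0-based, whence the sign \<open>(-1)^(k + 1)\<close>. The list \<open>ys\<close> of length
  \<open>r - 1\<close> only makes sense for positive rank.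
\<close>

definition phirotope :: "nat \<Rightarrow> nat \<Rightarrow> (nat list \<Rightarrow> complex) \<Rightarrow> bool" where
  "phirotope r n \<phi> \<longleftrightarrow>
     0 < r \<and>
     \<phi> \<in> tuples r n \<rightarrow>\<^sub>E S1 \<union> {0} \<and>
     (\<exists>xs\<in>tuples r n. \<phi> xs \<noteq> 0) \<and>
     alternating r n \<phi> \<and>
     (\<forall>xs\<in>tuples (r + 1) n. \<forall>ys\<in>tuples (r - 1) n.
        0 \<in> hypersum ((\<lambda>k. (-1) ^ (k + 1) * \<phi> (remove_at k xs) * \<phi> (xs ! k # ys)) ` {..<r + 1}))"

definition phased_matroid :: "nat \<Rightarrow> nat \<Rightarrow> (nat list \<Rightarrow> complex) set \<Rightarrow> bool" where
  "phased_matroid r n M \<longleftrightarrow>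
     (\<exists>\<phi>. phirotope r n \<phi> \<and> M = {(\<lambda>xs\<in>tuples r n. \<alpha> * \<phi> xs) | \<alpha>. \<alpha> \<in> S1})"

definition uniform_matroid :: "nat \<Rightarrow> nat \<Rightarrow> (nat list \<Rightarrow> complex) set \<Rightarrow> bool" where
  "uniform_matroid r n M \<longleftrightarrow> (\<forall>\<phi>\<in>M. \<forall>xs\<in>tuples r n. distinct xs \<longrightarrow> \<phi> xs \<noteq> 0)"

definition rephasing ::
    "nat \<Rightarrow> nat \<Rightarrow> (nat \<Rightarrow> complex) \<Rightarrow> (nat list \<Rightarrow> complex) \<Rightarrow> nat list \<Rightarrow> complex" where
  "rephasing r n \<rho> \<phi> = (\<lambda>xs\<in>tuples r n. (\<Prod>i<r. \<rho> (xs ! i)) * \<phi> xs)"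

definition essentially_oriented :: "nat \<Rightarrow> nat \<Rightarrow> (nat list \<Rightarrow> complex) set \<Rightarrow> bool" where
  "essentially_oriented r n M \<longleftrightarrow>
     (\<exists>\<phi>\<in>M. \<exists>\<rho>\<in>{..<n} \<rightarrow> S1. rephasing r n \<rho> \<phi> ` tuples r n \<subseteq> {-1, 0, 1})"

definition phirotope_of_mat :: "nat \<Rightarrow> nat \<Rightarrow> complex mat \<Rightarrow> nat list \<Rightarrow> complex" where
  "phirotope_of_mat r n A =
     (\<lambda>xs\<in>tuples r n. ph (Determinant.det (mat_of_cols r (map (col A) xs))))"

definition realizations :: "nat \<Rightarrow> nat \<Rightarrow> (nat list \<Rightarrow> complex) set \<Rightarrow> complex mat set" where
  "realizations r n M = {A \<in> carrier_mat r n. phirotope_of_mat r n A \<in> M}"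

definition realizable :: "nat \<Rightarrow> nat \<Rightarrow> (nat list \<Rightarrow> complex) set \<Rightarrow> bool" where
  "realizable r n M \<longleftrightarrow> realizations r n M \<noteq> {}"

text \<open>
  The type \<^typ>\<open>complex mat\<close> carries no topology; \<open>r \<times> n\<close> matrices are given the product
  topology of their entries.
\<close>

definition mat_topology :: "nat \<Rightarrow> nat \<Rightarrow> complex mat topology" where
  "mat_topology r n =
     pullback_topology (carrier_mat r n)
       (\<lambda>A. \<lambda>ij\<in>{..<r} \<times> {..<n}. A $$ ij)
       (product_topology (\<lambda>_. euclidean) ({..<r} \<times> {..<n}))"

definition quotient_topology :: "'a topology \<Rightarrow> ('a \<times> 'a) set \<Rightarrow> 'a set topology" where
  "quotient_topology X R =
     topology (\<lambda>U. U \<subseteq> topspace X // R \<and> openin X {x \<in> topspace X. R `` {x} \<in> U})"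

definition GL_rel :: "nat \<Rightarrow> complex mat set \<Rightarrow> (complex mat \<times> complex mat) set" where
  "GL_rel r S =
     {(A, B). A \<in> S \<and> B \<in> S \<and> (\<exists>P\<in>carrier_mat r r. invertible_mat P \<and> B = P * A)}"

definition realization_space ::
    "nat \<Rightarrow> nat \<Rightarrow> (nat list \<Rightarrow> complex) set \<Rightarrow> complex mat set topology" where
  "realization_space r n M =
     quotient_topology (subtopology (mat_topology r n) (realizations r n M))
       (GL_rel r (realizations r n M))"

lemma openin_quotient_topology:
  "openin (quotient_topology X R) U \<longleftrightarrow>
     U \<subseteq> topspace X // R \<and> openin X {x \<in> topspace X. R `` {x} \<in> U}"
proof -
  have "istopology (\<lambda>U. U \<subseteq> topspace X // R \<and> openin X {x \<in> topspace X. R `` {x} \<in> U})"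
    unfolding istopology_def
  proof (intro conjI allI impI; (elim conjE)?)
    fix S T
    assume "openin X {x \<in> topspace X. R `` {x} \<in> S}" "openin X {x \<in> topspace X. R `` {x} \<in> T}"
    then have "openin X ({x \<in> topspace X. R `` {x} \<in> S} \<inter> {x \<in> topspace X. R `` {x} \<in> T})"
      by (rule openin_Int)
    then show "openin X {x \<in> topspace X. R `` {x} \<in> S \<inter> T}"
      by (rule back_subst[of "openin X"]) auto
  next
    fix K
    assume K: "\<forall>U\<in>K. U \<subseteq> topspace X // R \<and> openin X {x \<in> topspace X. R `` {x} \<in> U}"
    then have "openin X (\<Union>U\<in>K. {x \<in> topspace X. R `` {x} \<in> U})"
      by (intro openin_Union) auto
    then show "openin X {x \<in> topspace X. R `` {x} \<in> \<Union>K}"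
      by (rule back_subst[of "openin X"]) auto
  qed auto
  then show ?thesis
    by (simp add: quotient_topology_def topology_inverse')
qed

lemma topspace_quotient_topology: "topspace (quotient_topology X R) = topspace X // R"
proof
  show "topspace (quotient_topology X R) \<subseteq> topspace X // R"
    using openin_quotient_topology[of X R] openin_topspace by blast
  have "{x \<in> topspace X. R `` {x} \<in> topspace X // R} = topspace X"
    by (auto simp: quotient_def)
  then have "openin (quotient_topology X R) (topspace X // R)"
    by (simp add: openin_quotient_topology)
  then show "topspace X // R \<subseteq> topspace (quotient_topology X R)"
    by (rule openin_subset)
qed

lemma quotient_map_quotient_topology: "quotient_map X (quotient_topology X R) (\<lambda>x. R `` {x})"
  unfolding quotient_map_def
  by (auto simp: openin_quotient_topology topspace_quotient_topology quotient_def)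

lemma topspace_mat_topology: "topspace (mat_topology r n) = carrier_mat r n"
  by (auto simp: mat_topology_def topspace_pullback_topology)

lemma invertible_matE:
  assumes P: "P \<in> carrier_mat r r" and inv: "invertible_mat P"
  obtains Q where "Q \<in> carrier_mat r r" "P * Q = 1\<^sub>m r" "Q * P = 1\<^sub>m r"
proof -
  from inv P obtain Q where Q1: "P * Q = 1\<^sub>m r" and Q2: "Q * P = 1\<^sub>m (dim_row Q)"
    by (auto simp: invertible_mat_def inverts_mat_def)
  have "dim_col Q = r"
    using arg_cong[OF Q1, of dim_col] by simp
  moreover have "dim_row Q = r"
    using arg_cong[OF Q2, of dim_col] P by simp
  ultimately show ?thesis
    using that[of Q] Q1 Q2 by auto
qed

lemma equiv_GL_rel:
  assumes S: "S \<subseteq> carrier_mat r n"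
  shows "equiv S (GL_rel r S)"
proof (rule equivI)
  show "GL_rel r S \<subseteq> S \<times> S"
    by (auto simp: GL_rel_def)
  show "refl_on S (GL_rel r S)"
  proof (rule refl_onI)
    fix A assume A: "A \<in> S"
    have "invertible_mat (1\<^sub>m r :: complex mat)"
      by (auto simp: invertible_mat_def inverts_mat_def intro!: exI[of _ "1\<^sub>m r"])
    moreover have "A = 1\<^sub>m r * A"
      using A S by auto
    ultimately show "(A, A) \<in> GL_rel r S"
      using A by (auto simp: GL_rel_def intro!: bexI[of _ "1\<^sub>m r"])
  qed
  show "sym (GL_rel r S)"
  proof (rule symI)
    fix A B assume "(A, B) \<in> GL_rel r S"
    then obtain P where A: "A \<in> S" and B: "B \<in> S" and P: "P \<in> carrier_mat r r"
      and inv: "invertible_mat P" and eq: "B = P * A"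
      by (auto simp: GL_rel_def)
    from P inv obtain Q where Q: "Q \<in> carrier_mat r r"
      and Q1: "P * Q = 1\<^sub>m r" and Q2: "Q * P = 1\<^sub>m r"
      by (rule invertible_matE)
    have "A \<in> carrier_mat r n"
      using A S by auto
    then have "A = Q * B"
      using P Q Q2 eq by (simp flip: assoc_mult_mat[of Q r r P r A n])
    moreover have "invertible_mat Q"
      using P Q Q1 Q2 by (auto simp: invertible_mat_def inverts_mat_def)
    ultimately show "(B, A) \<in> GL_rel r S"
      using A B Q by (auto simp: GL_rel_def)
  qed
  show "trans (GL_rel r S)"
  proof (rule transI)
    fix A B C assume "(A, B) \<in> GL_rel r S" "(B, C) \<in> GL_rel r S"
    then obtain P Q where A: "A \<in> S" and C: "C \<in> S"
      and P: "P \<in> carrier_mat r r" "invertible_mat P" and eqB: "B = P * A"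
      and Q: "Q \<in> carrier_mat r r" "invertible_mat Q" and eqC: "C = Q * B"
      by (auto simp: GL_rel_def)
    have "A \<in> carrier_mat r n"
      using A S by auto
    then have "C = (Q * P) * A"
      using P Q eqB eqC by (simp add: assoc_mult_mat[of Q r r P r A n])
    moreover have "invertible_mat (Q * P)"
    proof -
      from P obtain P' where P': "P' \<in> carrier_mat r r" "P * P' = 1\<^sub>m r" "P' * P = 1\<^sub>m r"
        by (rule invertible_matE)
      from Q obtain Q' where Q': "Q' \<in> carrier_mat r r" "Q * Q' = 1\<^sub>m r" "Q' * Q = 1\<^sub>m r"
        by (rule invertible_matE)
      have "(Q * P) * (P' * Q') = Q * ((P * P') * Q')"
        using P(1) Q(1) P'(1) Q'(1)
        by (simp add: assoc_mult_mat[of Q r r P r "P' * Q'" r] assoc_mult_mat[of P r r P' r Q' r])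
      moreover have "(P' * Q') * (Q * P) = P' * ((Q' * Q) * P)"
        using P(1) Q(1) P'(1) Q'(1)
        by (simp add: assoc_mult_mat[of P' r r Q' r "Q * P" r] assoc_mult_mat[of Q' r r Q r P r])
      ultimately show ?thesis
        using P Q P' Q'
        by (auto simp: invertible_mat_def inverts_mat_def intro!: exI[of _ "P' * Q'"])
    qed
    ultimately show "(A, C) \<in> GL_rel r S"
      using A C P Q by (auto simp: GL_rel_def)
  qed
qed

end

theory Submission
  imports Defs
begin

text \<open>
  After a change of basis a realization is \<open>(I | X)\<close>, where the entries and the \<open>2 \<times> 2\<close> minors of
  \<open>X\<close> are maximal minors, so their phases are prescribed. For a second realization \<open>(I | Y)\<close> the
  ratios \<open>t\<^sub>i\<^sub>j = y\<^sub>i\<^sub>j / x\<^sub>i\<^sub>j\<close> are therefore positive, and the phase of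
  \<open>x\<^sub>i\<^sub>j x\<^sub>k\<^sub>l - x\<^sub>i\<^sub>l x\<^sub>k\<^sub>j\<close> forces the cross ratio of \<open>t\<close> at \<open>(i, k; j, l)\<close> to be \<open>1\<close> as soon as
  that of \<open>x\<close> is not real. Cross ratios are multiplicative, so both conditions define equivalence
  relations on columns and then on rows; as the union of two equivalence relations is full
  only if one of them is, either all cross ratios of \<open>x\<close> are real, which makes the matroid
  essentially oriented, or \<open>t\<close> has rank one. Hence all realizations arise from a single one by
  \<open>GL(r)\<close> and positive scalings of the columns, and the scaling factors, up to a common factor,
  are continuous functions of ratios of absolute values of minors.
\<close>

unbundle no vec_syntax

subsection \<open>Maximal minors\<close>

definition select_cols :: "nat \<Rightarrow> 'a mat \<Rightarrow> nat list \<Rightarrow> 'a mat" where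
  "select_cols r A xs = mat_of_cols r (map (col A) xs)"

text \<open>The determinant before its phase is taken, as in \<open>phirotope_of_mat\<close>. Unlike
  the phases, these values also carry the absolute values that later serve as coordinates.\<close>

definition minor :: "nat \<Rightarrow> 'a :: comm_ring_1 mat \<Rightarrow> nat list \<Rightarrow> 'a" where
  "minor r A xs = Determinant.det (select_cols r A xs)"

lemma tuples_nth: "xs \<in> tuples k n \<Longrightarrow> i < k \<Longrightarrow> xs ! i < n"
  unfolding tuples_def using nth_mem by fastforce

lemma length_tuples: "xs \<in> tuples k n \<Longrightarrow> length xs = k"
  by (simp add: tuples_def)

lemma tuples_update: "xs \<in> tuples k n \<Longrightarrow> j < n \<Longrightarrow> xs[i := j] \<in> tuples k n"
  unfolding tuples_def using set_update_subset_insert by fastforce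

lemma select_cols_carrier: "xs \<in> tuples k n \<Longrightarrow> select_cols r A xs \<in> carrier_mat r k"
  by (auto simp: select_cols_def tuples_def intro: carrier_matI)

lemma select_cols_index:
  assumes "A \<in> carrier_mat r n" "xs \<in> tuples k n" "i < r" "j < k"
  shows "select_cols r A xs $$ (i, j) = A $$ (i, xs ! j)"
  using assms tuples_nth[of xs k n j] by (simp add: select_cols_def mat_of_cols_index length_tuples)

lemma select_cols_mult:
  fixes A :: "'a :: comm_ring_1 mat"
  assumes "P \<in> carrier_mat r r" "A \<in> carrier_mat r n" "xs \<in> tuples k n"
  shows "select_cols r (P * A) xs = P * select_cols r A xs"
proof (rule eq_matI)
  have c: "select_cols r (P * A) xs \<in> carrier_mat r k" "P * select_cols r A xs \<in> carrier_mat r k"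
    using select_cols_carrier[OF assms(3)] mult_carrier_mat[OF assms(1)] by blast+
  then show "dim_row (select_cols r (P * A) xs) = dim_row (P * select_cols r A xs)"
    "dim_col (select_cols r (P * A) xs) = dim_col (P * select_cols r A xs)" by auto
  fix i j assume "i < dim_row (P * select_cols r A xs)" "j < dim_col (P * select_cols r A xs)"
  then have ij: "i < r" "j < k" using c by auto
  have "col (select_cols r A xs) j = col A (xs ! j)"
    using assms ij tuples_nth[OF assms(3), of j]
    by (auto simp: select_cols_def length_tuples intro!: col_mat_of_cols)
  then show "select_cols r (P * A) xs $$ (i, j) = (P * select_cols r A xs) $$ (i, j)"
    using assms ij tuples_nth[OF assms(3), of j] select_cols_carrier[OF assms(3), of r A]
    by (subst select_cols_index[where n = n and k = k]) auto
qed

text \<open>\<open>GL(r)\<close> multiplies all maximal minors by one common factor, so quotients of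
  minors are constant on its orbits.\<close>

lemma minor_mult:
  assumes "P \<in> carrier_mat r r" "A \<in> carrier_mat r n" "xs \<in> tuples r n"
  shows "minor r (P * A) xs = Determinant.det P * minor r A xs"
  unfolding minor_def select_cols_mult[OF assms]
  using Determinant.det_mult[OF assms(1) select_cols_carrier[OF assms(3)]] .

lemma det_mat_diag: "Determinant.det (mat_diag n f) = (\<Prod>i<n. f i)"
proof -
  have "Determinant.det (mat_diag n f) = prod_list (diag_mat (mat_diag n f))"
    by (rule det_upper_triangular[where n = n]) (auto simp: upper_triangular_def mat_diag_def)
  also have "diag_mat (mat_diag n f) = map f [0..<n]"
    by (auto simp: diag_mat_def mat_diag_def)
  also have "prod_list (map f [0..<n]) = (\<Prod>i<n. f i)"
    by (simp add: prod.distinct_set_conv_list[symmetric] lessThan_atLeast0)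
  finally show ?thesis .
qed

lemma minor_scale_cols:
  assumes "A \<in> carrier_mat r n" "xs \<in> tuples r n"
  shows "minor r (A * mat_diag n d) xs = minor r A xs * (\<Prod>i<r. d (xs ! i))"
proof -
  have "select_cols r (A * mat_diag n d) xs = select_cols r A xs * mat_diag r (\<lambda>i. d (xs ! i))"
    unfolding mat_diag_mult_right[OF select_cols_carrier[OF assms(2)]]
    unfolding mat_diag_mult_right[OF assms(1)]
    using assms select_cols_carrier[OF assms(2), of r "Matrix.mat r n (\<lambda>(i, j). A $$ (i, j) * d j)"]
      tuples_nth[OF assms(2)]
    by (intro eq_matI) (auto simp: select_cols_index[OF _ assms(2)])
  then show ?thesis
    by (simp add: minor_def Determinant.det_mult[OF select_cols_carrier[OF assms(2)]] det_mat_diag)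
qed

text \<open>Every term of the Leibniz expansion is real. Minors of a real matrix therefore have
  phases in {-1, 0, 1}, which is what essential orientation asks for.\<close>

lemma minor_Reals:
  fixes A :: "complex mat"
  assumes "A \<in> carrier_mat r n" "xs \<in> tuples r n" "\<And>i j. i < r \<Longrightarrow> j < n \<Longrightarrow> A $$ (i, j) \<in> \<real>"
  shows "minor r A xs \<in> \<real>"
proof -
  have "signof p \<in> (\<real> :: complex set)" for p :: "nat \<Rightarrow> nat"
    by (auto simp: sign_def)
  moreover have "(\<Prod>i = 0..<r. select_cols r A xs $$ (i, p i)) \<in> \<real>" if "p permutes {0..<r}" for p
  proof (rule prod_in_Reals)
    fix i assume "i \<in> {0..<r}"
    moreover from this have "p i < r" using permutes_in_image[OF that, of i] by auto
    ultimately show "select_cols r A xs $$ (i, p i) \<in> \<real>"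
      using assms tuples_nth[OF assms(2)] by (simp add: select_cols_index[OF assms(1,2)])
  qed
  ultimately show ?thesis
    unfolding minor_def det_def'[OF select_cols_carrier[OF assms(2)]]
    by (intro sum_in_Reals Reals_mult) auto
qed

section \<open>Column exchange and identity matrices with one or two columns replaced\<close>

lemma select_cols_update:
  assumes "A \<in> carrier_mat r n" "xs \<in> tuples r n" "j < n"
  shows "select_cols r A (xs[i := j]) = replace_col (select_cols r A xs) (col A j) i"
  using assms tuples_update[OF assms(2,3), of i] select_cols_carrier[of xs r n r A]
    select_cols_carrier[of "xs[i := j]" r n r A]
  by (intro eq_matI)
    (auto simp: replace_col_def select_cols_index nth_list_update length_tuples)

text \<open>Cramer's rule for the system with the identity as coefficient matrix, whose solution is
  \<open>v\<close> itself.\<close>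

lemma det_replace_col_one:
  fixes v :: "'a :: field Matrix.vec"
  assumes "v \<in> carrier_vec r" "i < r"
  shows "Determinant.det (replace_col (1\<^sub>m r) v i) = v $ i"
  using cramer_lemma_mat[of "1\<^sub>m r" r v i] assms by simp

text \<open>Cramer's rule once more, now for the identity with column \<open>i\<close> replaced by
  \<open>v\<close>. Its determinant is \<open>v $ i\<close>, and dividing by this entry solves the
  system with right-hand side \<open>w\<close>.\<close>

lemma det_replace_two_cols_one:
  fixes v w :: "'a :: field Matrix.vec"
  assumes v: "v \<in> carrier_vec r" and w: "w \<in> carrier_vec r" and ik: "i < r" "k < r" "i \<noteq> k"
    and nz: "v $ i \<noteq> 0"
  shows "Determinant.det (replace_col (replace_col (1\<^sub>m r) v i) w k) =
    v $ i * w $ k - w $ i * v $ k"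
proof -
  define R where "R = replace_col (1\<^sub>m r) v i"
  \<comment> \<open>The solution of \<open>R *\<^sub>v u = w\<close>: row \<open>i\<close> reads
    \<open>v $ i * u $ i = w $ i\<close>, and any other row \<open>m\<close> reads
    \<open>v $ m * u $ i + u $ m = w $ m\<close>.\<close>
  define u where
    "u = Matrix.vec r (\<lambda>m. if m = i then w $ i / v $ i else w $ m - w $ i / v $ i * v $ m)"
  have R: "R \<in> carrier_mat r r" by (simp add: R_def replace_col_def)
  have u: "u \<in> carrier_vec r" by (simp add: u_def)
  have "R *\<^sub>v u = w"
  proof (rule eq_vecI)
    show "dim_vec (R *\<^sub>v u) = dim_vec w" using R w by auto
    fix m assume "m < dim_vec w"
    then have m: "m < r" using w by auto
    have "(R *\<^sub>v u) $ m = (\<Sum>l\<in>{0..<r}. R $$ (m, l) * u $ l)"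
      using m R u by (auto simp: scalar_prod_def)
    \<comment> \<open>Off column \<open>i\<close> the matrix \<open>R\<close> agrees with the
      identity, so at most the term \<open>u $ m\<close> survives next to the split-off one.\<close>
    also have "\<dots> = R $$ (m, i) * u $ i + (\<Sum>l\<in>{0..<r} - {i}. R $$ (m, l) * u $ l)"
      using ik by (subst sum.remove[of _ i]) auto
    also have "(\<Sum>l\<in>{0..<r} - {i}. R $$ (m, l) * u $ l) =
        (\<Sum>l\<in>{0..<r} - {i}. if l = m then u $ m else 0)"
      using m by (intro sum.cong) (auto simp: R_def replace_col_def)
    also have "\<dots> = (if m = i then 0 else u $ m)"
      using m by (subst sum.delta) auto
    finally show "(R *\<^sub>v u) $ m = w $ m"
      using m ik nz by (auto simp: R_def replace_col_def u_def)
  qed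
  then have "Determinant.det (replace_col R w k) = u $ k * Determinant.det R"
    using cramer_lemma_mat[OF R u ik(2)] by simp
  also have "Determinant.det R = v $ i"
    unfolding R_def by (rule det_replace_col_one) (use v ik in auto)
  also have "u $ k * v $ i = v $ i * w $ k - w $ i * v $ k"
    using ik nz by (simp add: u_def left_diff_distrib)
  finally show ?thesis
    unfolding R_def .
qed

lemma invertible_mat_iff_det:
  fixes P :: "'a :: field mat"
  assumes P: "P \<in> carrier_mat r r"
  shows "invertible_mat P \<longleftrightarrow> Determinant.det P \<noteq> 0"
proof
  assume "invertible_mat P"
  then obtain Q where Q: "P * Q = 1\<^sub>m r" "Q * P = 1\<^sub>m (dim_row Q)"
    using P by (auto simp: invertible_mat_def inverts_mat_def)
  have "Q \<in> carrier_mat r r"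
    using arg_cong[OF Q(1), of dim_col] arg_cong[OF Q(2), of dim_col] P by auto
  then have "Determinant.det P * Determinant.det Q = 1"
    using Determinant.det_mult[OF P, of Q] Q(1) by simp
  then show "Determinant.det P \<noteq> 0" by auto
next
  assume "Determinant.det P \<noteq> 0"
  from det_non_zero_imp_unit[OF P this, of "()"]
  obtain Q where "Q \<in> carrier_mat r r" "Q * P = 1\<^sub>m r" "P * Q = 1\<^sub>m r"
    by (auto simp: Units_def ring_mat_def)
  then show "invertible_mat P"
    using P by (auto simp: invertible_mat_def inverts_mat_def)
qed

section \<open>The normal form (I | X) and its minors\<close>

lemma upt_in_tuples: "r \<le> n \<Longrightarrow> [0..<r] \<in> tuples r n"
  by (auto simp: tuples_def)

text \<open>\<open>P\<close> is the block of the first \<open>r\<close> columns of \<open>A\<close>,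
  and \<open>N\<close> is its inverse times \<open>A\<close>.\<close>

lemma normal_form:
  fixes A :: "'a :: field mat"
  assumes A: "A \<in> carrier_mat r n" and rn: "r \<le> n" and nz: "minor r A [0..<r] \<noteq> 0"
  obtains P N where "P \<in> carrier_mat r r" "Determinant.det P \<noteq> 0" "N \<in> carrier_mat r n"
    "A = P * N" "select_cols r N [0..<r] = 1\<^sub>m r"
proof -
  define P where "P = select_cols r A [0..<r]"
  have P: "P \<in> carrier_mat r r"
    unfolding P_def by (rule select_cols_carrier[OF upt_in_tuples[OF rn]])
  have dP: "Determinant.det P \<noteq> 0"
    using nz by (simp add: P_def minor_def)
  from det_non_zero_imp_unit[OF P dP, of "()"]
  obtain Q where Q: "Q \<in> carrier_mat r r" "Q * P = 1\<^sub>m r" "P * Q = 1\<^sub>m r"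
    by (auto simp: Units_def ring_mat_def)
  have "A = P * (Q * A)"
    using A P Q by (simp flip: assoc_mult_mat[of P r r Q r A n])
  moreover have "select_cols r (Q * A) [0..<r] = 1\<^sub>m r"
    using select_cols_mult[OF Q(1) A upt_in_tuples[OF rn]] Q(2) by (simp add: P_def)
  moreover have "Q * A \<in> carrier_mat r n" using Q A by simp
  ultimately show ?thesis using that P dP by blast
qed

lemma normal_form_entry:
  assumes "N \<in> carrier_mat r n" "r \<le> n" "select_cols r N [0..<r] = 1\<^sub>m r" "i < r" "j < r"
  shows "N $$ (i, j) = (if i = j then 1 else 0)"
  using select_cols_index[OF assms(1) upt_in_tuples[OF assms(2)] assms(4,5)] assms by simp

lemma normal_form_minor1:
  fixes N :: "'a :: field mat"
  assumes "N \<in> carrier_mat r n" "r \<le> n" "select_cols r N [0..<r] = 1\<^sub>m r" "i < r" "j < n"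
  shows "minor r N ([0..<r][i := j]) = N $$ (i, j)"
  using assms
  by (auto simp: minor_def select_cols_update upt_in_tuples det_replace_col_one)

text \<open>The selected columns form the identity with columns \<open>i\<close> and
  \<open>k\<close> replaced, so a 2 x 2 minor of \<open>N\<close> is a maximal minor and its phase
  is visible to the matroid.\<close>

lemma normal_form_minor2:
  fixes N :: "'a :: field mat"
  assumes "N \<in> carrier_mat r n" "r \<le> n" "select_cols r N [0..<r] = 1\<^sub>m r"
    "i < r" "k < r" "i \<noteq> k" "j < n" "l < n" "N $$ (i, j) \<noteq> 0"
  shows "minor r N ([0..<r][i := j, k := l]) =
    N $$ (i, j) * N $$ (k, l) - N $$ (i, l) * N $$ (k, j)"
  using assms det_replace_two_cols_one[of "col N j" r "col N l" i k]
  by (simp add: minor_def select_cols_update[where n = n] upt_in_tuples tuples_update)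

lemma distinct_upt_update:
  assumes "j \<ge> r"
  shows "distinct ([0..<r][i := j])"
  using assms by (intro distinct_list_update) auto

subsection \<open>Phases and cross ratios\<close>

text \<open>Equal phases give \<open>c * (t * a - s * b) = c' * (a - b)\<close> with
  \<open>c\<close>, \<open>c'\<close> the absolute values, that is,
  \<open>(c * t - c') * a = (c * s - c') * b\<close>. As \<open>a / b\<close> is not real,
  \<open>a\<close> and \<open>b\<close> are linearly independent over the reals, so
  \<open>c * t = c' = c * s\<close>.\<close>

lemma phase_rigidity:
  fixes a b :: complex and s t :: real
  assumes "b \<noteq> 0" "a / b \<notin> \<real>" "sgn (a - b) = sgn (of_real t * a - of_real s * b)"
  shows "t = s"
proof -
  define c where "c = cmod (a - b)"
  define c' where "c' = cmod (of_real t * a - of_real s * b)"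
  have "of_real c * (of_real t * a - of_real s * b) = of_real c' * (a - b)"
  proof -
    have *: "z = of_real (cmod z) * sgn z" for z :: complex
      by (simp add: sgn_eq)
    have "of_real t * a - of_real s * b = of_real c' * sgn (a - b)" "a - b = of_real c * sgn (a - b)"
      unfolding c_def c'_def using * assms(3) by metis+
    then show ?thesis by (metis mult.left_commute)
  qed
  then have eq: "of_real (c * t - c') * a = of_real (c * s - c') * b"
    by (simp add: algebra_simps)
  have "c * t = c'"
  proof (rule ccontr)
    assume "c * t \<noteq> c'"
    then have nz: "of_real (c * t - c') \<noteq> (0 :: complex)"
      by (simp only: of_real_eq_0_iff right_minus_eq not_False_eq_True)
    then have "a / b = of_real (c * s - c') / of_real (c * t - c')"
      using eq assms(1) frac_eq_eq[OF assms(1) nz] by (metis mult.commute)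
    also have "\<dots> \<in> \<real>" by (intro Reals_divide Reals_of_real)
    finally show False using assms(2) by simp
  qed
  moreover from this have "c * s = c'"
    using eq assms(1) by (simp flip: of_real_diff of_real_mult)
  \<comment> \<open>Otherwise \<open>a = b\<close>, and \<open>a / b = 1\<close> would be
    real.\<close>
  moreover have "c \<noteq> 0"
    using assms by (auto simp: c_def)
  ultimately show ?thesis using mult_cancel_left[of c t s] by simp
qed

text \<open>The analogue of the fact that a group is not the union of two proper subgroups. Fix
  \<open>(a, b)\<close> outside \<open>T\<close>, hence in \<open>E\<close>. An \<open>x\<close> not
  \<open>E\<close>-related to \<open>a\<close> is \<open>T\<close>-related to \<open>a\<close>, so
  not to \<open>b\<close>, so it is \<open>E\<close>-related to \<open>b\<close> and thereby to
  \<open>a\<close> after all.\<close>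

lemma equiv_Un_full:
  assumes E: "equiv S E" and T: "equiv S T" and full: "S \<times> S \<subseteq> E \<union> T"
  shows "S \<times> S \<subseteq> E \<or> S \<times> S \<subseteq> T"
proof (rule disjCI)
  assume "\<not> S \<times> S \<subseteq> T"
  then obtain a b where ab: "a \<in> S" "b \<in> S" "(a, b) \<notin> T" by auto
  have symE: "(y, x) \<in> E" if "(x, y) \<in> E" for x y using that equiv_def[of S E] E by (metis symD)
  have symT: "(y, x) \<in> T" if "(x, y) \<in> T" for x y using that equiv_def[of S T] T by (metis symD)
  have transE: "(x, z) \<in> E" if "(x, y) \<in> E" "(y, z) \<in> E" for x y z
    using that equiv_def[of S E] E by (metis transD)
  have transT: "(x, z) \<in> T" if "(x, y) \<in> T" "(y, z) \<in> T" for x y z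
    using that equiv_def[of S T] T by (metis transD)
  have "(a, b) \<in> E" using ab full by auto
  have "(a, x) \<in> E" if "x \<in> S" for x
  proof (rule ccontr)
    assume "(a, x) \<notin> E"
    then have "(a, x) \<in> T" using that ab full by auto
    then have "(b, x) \<notin> T" using symT transT ab(3) by blast
    then have "(b, x) \<in> E" using that ab full by auto
    then show False using \<open>(a, b) \<in> E\<close> \<open>(a, x) \<notin> E\<close> transE by blast
  qed
  then show "S \<times> S \<subseteq> E" by (auto intro: transE[OF symE])
qed

text \<open>For nonzero entries the value is 1 exactly when the 2 x 2 submatrix on rows
  \<open>i\<close>, \<open>k\<close> and columns \<open>j\<close>, \<open>l\<close> is singular. It
  does not change when rows or columns are multiplied by nonzero factors.\<close>

definition cross :: "('i \<Rightarrow> 'j \<Rightarrow> 'a :: field) \<Rightarrow> 'i \<Rightarrow> 'i \<Rightarrow> 'j \<Rightarrow> 'j \<Rightarrow> 'a" where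
  "cross f i k j l = f i j * f k l / (f i l * f k j)"

text \<open>Zero may belong to \<open>H\<close>, because \<open>inverse 0 = 0\<close>; thus the set
  of all real numbers qualifies as well as \<open>{1}\<close>. These are the two instances
  needed.\<close>

definition mult_subgroup :: "'a :: field set \<Rightarrow> bool" where
  "mult_subgroup H \<longleftrightarrow> 1 \<in> H \<and> (\<forall>x\<in>H. \<forall>y\<in>H. x * y \<in> H) \<and> (\<forall>x\<in>H. inverse x \<in> H)"

lemma mult_subgroup_Reals: "mult_subgroup (\<real> :: 'a :: {real_div_algebra, field} set)"
  by (auto simp: mult_subgroup_def)

lemma mult_subgroup_one: "mult_subgroup {1}"
  by (auto simp: mult_subgroup_def)

lemma cross_trans_cols:
  assumes "f i l \<noteq> 0" "f k l \<noteq> 0"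
  shows "cross f i k j m = cross f i k j l * cross f i k l m"
  using assms by (simp add: cross_def)

lemma cross_trans_rows:
  assumes "f k j \<noteq> 0" "f k l \<noteq> 0"
  shows "cross f i m j l = cross f i k j l * cross f k m j l"
  using assms by (simp add: cross_def)

lemma cross_swap:
  "cross f i k l j = inverse (cross f i k j l)" "cross f k i j l = inverse (cross f i k j l)"
  by (simp_all add: cross_def mult.commute)

lemma cross_equiv_cols:
  assumes H: "mult_subgroup H" and nz: "\<And>i j. i \<in> I \<Longrightarrow> j \<in> J \<Longrightarrow> f i j \<noteq> 0"
    and ik: "i \<in> I" "k \<in> I"
  shows "equiv J {(j, l) \<in> J \<times> J. cross f i k j l \<in> H}"
proof (rule equivI)
  show "refl_on J {(j, l) \<in> J \<times> J. cross f i k j l \<in> H}"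
    using assms by (auto simp: refl_on_def cross_def mult_subgroup_def)
  have "cross f i k l j \<in> H" if "cross f i k j l \<in> H" for j l
    using that H by (subst cross_swap(1)) (auto simp: mult_subgroup_def)
  then show "sym {(j, l) \<in> J \<times> J. cross f i k j l \<in> H}"
    by (auto simp: sym_def)
  have "cross f i k j m \<in> H"
    if "l \<in> J" "cross f i k j l \<in> H" "cross f i k l m \<in> H" for j l m
    using that H nz ik by (subst cross_trans_cols[of f i l k]) (auto simp: mult_subgroup_def)
  then show "trans {(j, l) \<in> J \<times> J. cross f i k j l \<in> H}"
    unfolding trans_def by blast
qed auto

text \<open>Quantifying over all column pairs leaves a relation between rows alone. The three laws
  again come from 1, inverses and products in \<open>H\<close>.\<close>

lemma cross_equiv_rows:
  assumes H: "mult_subgroup H" and nz: "\<And>i j. i \<in> I \<Longrightarrow> j \<in> J \<Longrightarrow> f i j \<noteq> 0"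
  shows "equiv I {(i, k) \<in> I \<times> I. \<forall>j\<in>J. \<forall>l\<in>J. cross f i k j l \<in> H}"
proof (rule equivI)
  show "refl_on I {(i, k) \<in> I \<times> I. \<forall>j\<in>J. \<forall>l\<in>J. cross f i k j l \<in> H}"
    using assms by (auto simp: refl_on_def cross_def mult_subgroup_def mult.commute)
  have "cross f k i j l \<in> H" if "cross f i k j l \<in> H" for i k j l
    using that H by (subst cross_swap(2)) (auto simp: mult_subgroup_def)
  then show "sym {(i, k) \<in> I \<times> I. \<forall>j\<in>J. \<forall>l\<in>J. cross f i k j l \<in> H}"
    by (auto simp: sym_def)
  have "cross f i m j l \<in> H"
    if "j \<in> J" "l \<in> J" "k \<in> I" "cross f i k j l \<in> H" "cross f k m j l \<in> H" for i k m j l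
    using that H nz by (subst cross_trans_rows[of f k]) (auto simp: mult_subgroup_def)
  then show "trans {(i, k) \<in> I \<times> I. \<forall>j\<in>J. \<forall>l\<in>J. cross f i k j l \<in> H}"
    unfolding trans_def by blast
qed auto

text \<open>\<open>equiv_Un_full\<close> is used twice: for fixed rows on the columns, which makes
  one of the two conditions uniform in the column pair, and then on the rows, which makes it uniform
  altogether.\<close>

lemma cross_dichotomy:
  assumes H: "mult_subgroup H" "\<And>i j. i \<in> I \<Longrightarrow> j \<in> J \<Longrightarrow> f i j \<noteq> 0"
    and K: "mult_subgroup K" "\<And>i j. i \<in> I \<Longrightarrow> j \<in> J \<Longrightarrow> g i j \<noteq> 0"
    and full: "\<And>i k j l. i \<in> I \<Longrightarrow> k \<in> I \<Longrightarrow> j \<in> J \<Longrightarrow> l \<in> J \<Longrightarrow>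
      cross f i k j l \<in> H \<or> cross g i k j l \<in> K"
  shows "(\<forall>i\<in>I. \<forall>k\<in>I. \<forall>j\<in>J. \<forall>l\<in>J. cross f i k j l \<in> H) \<or>
    (\<forall>i\<in>I. \<forall>k\<in>I. \<forall>j\<in>J. \<forall>l\<in>J. cross g i k j l \<in> K)"
proof -
  have "(\<forall>j\<in>J. \<forall>l\<in>J. cross f i k j l \<in> H) \<or> (\<forall>j\<in>J. \<forall>l\<in>J. cross g i k j l \<in> K)"
    if "i \<in> I" "k \<in> I" for i k
  proof -
    have "equiv J {(j, l) \<in> J \<times> J. cross f i k j l \<in> H}"
      "equiv J {(j, l) \<in> J \<times> J. cross g i k j l \<in> K}"
      using cross_equiv_cols[of H I J f i k] cross_equiv_cols[of K I J g i k] H K that by blast+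
    from equiv_Un_full[OF this] show ?thesis using full[OF that] by auto
  qed
  moreover have "equiv I {(i, k) \<in> I \<times> I. \<forall>j\<in>J. \<forall>l\<in>J. cross f i k j l \<in> H}"
    "equiv I {(i, k) \<in> I \<times> I. \<forall>j\<in>J. \<forall>l\<in>J. cross g i k j l \<in> K}"
    using cross_equiv_rows[of H I J f] cross_equiv_rows[of K I J g] H K by blast+
  note equiv_Un_full[OF this]
  ultimately show ?thesis by auto
qed

text \<open>Up to a factor for row \<open>i\<close> and a factor for column \<open>j\<close>, the
  entry is a cross ratio with fixed base row \<open>i0\<close> and base column \<open>j0\<close>. If
  cross ratios are 1, \<open>f\<close> has rank one; if they are real, \<open>f\<close> is real up
  to scaling rows and columns.\<close>

lemma cross_factor:
  assumes "f i j0 \<noteq> 0" "f i0 j \<noteq> 0" "f i0 j0 \<noteq> 0"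
  shows "f i j = f i j0 * cross f i i0 j j0 * (f i0 j / f i0 j0)"
  using assms by (simp add: cross_def)

section \<open>Normal forms up to scaling of rows and columns\<close>

lemma diag_mult_diagI:
  assumes "N \<in> carrier_mat r n" "W \<in> carrier_mat r n"
    and "\<And>i j. i < r \<Longrightarrow> j < n \<Longrightarrow> N $$ (i, j) = p i * W $$ (i, j) * d j"
  shows "N = mat_diag r p * (W * mat_diag n d)"
proof -
  have "W * mat_diag n d \<in> carrier_mat r n"
    using assms(2) by (simp add: mult_carrier_mat[where n = n])
  from mat_diag_mult_left[OF this] show ?thesis
    using assms by (auto simp: mat_diag_mult_right[OF assms(2)] mult.assoc intro!: eq_matI)
qed

lemma normal_form_nonzero:
  fixes N :: "'a :: field mat"
  assumes "N \<in> carrier_mat r n" "r \<le> n" "select_cols r N [0..<r] = 1\<^sub>m r"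
    and "\<And>xs. xs \<in> tuples r n \<Longrightarrow> distinct xs \<Longrightarrow> minor r N xs \<noteq> 0"
    and "i < r" "r \<le> j" "j < n"
  shows "N $$ (i, j) \<noteq> 0"
  using assms(4)[of "[0..<r][i := j]"] normal_form_minor1[OF assms(1-3,5,7)] assms
  by (simp add: tuples_update upt_in_tuples distinct_upt_update)

text \<open>The nonreal cross ratio of \<open>N\<close> rules out one alternative of
  \<open>cross_dichotomy\<close>, so all cross ratios of \<open>t\<close> are 1. The factors
  \<open>p\<close> and \<open>d\<close> are then read off from \<open>cross_factor\<close> with base
  row \<open>i0\<close> and base column \<open>j0\<close>.\<close>

lemma normal_form_rigidity:
  fixes N N' :: "complex mat"
  assumes N: "N \<in> carrier_mat r n" "r \<le> n" "select_cols r N [0..<r] = 1\<^sub>m r"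
    and N'_normal: "N' \<in> carrier_mat r n" "select_cols r N' [0..<r] = 1\<^sub>m r"
    and uniform: "\<And>xs. xs \<in> tuples r n \<Longrightarrow> distinct xs \<Longrightarrow> minor r N xs \<noteq> 0"
    and phase: "\<And>xs. xs \<in> tuples r n \<Longrightarrow> sgn (minor r N' xs) = sgn (minor r N xs)"
    and nonreal: "i0 < r" "k0 < r" "j0 \<in> {r..<n}" "l0 \<in> {r..<n}"
      "cross (\<lambda>i j. N $$ (i, j)) i0 k0 j0 l0 \<notin> \<real>"
  obtains p d :: "nat \<Rightarrow> real" where "\<And>i. i < r \<Longrightarrow> 0 < p i" "\<And>j. j < n \<Longrightarrow> 0 < d j"
    "N' = mat_diag r (\<lambda>i. of_real (p i)) * (N * mat_diag n (\<lambda>j. of_real (d j)))"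
proof -
  note N' = N'_normal(1) N(2) N'_normal(2)
  define x where "x = (\<lambda>i j. N $$ (i, j))"
  define t where "t = (\<lambda>i j. cmod (N' $$ (i, j)) / cmod (x i j))"
  have x0: "x i j \<noteq> 0" if "i \<in> {..<r}" "j \<in> {r..<n}" for i j
    using that normal_form_nonzero[OF N uniform, of i j] by (simp add: x_def)
  have sgn_entry: "sgn (N' $$ (i, j)) = sgn (x i j)" if "i \<in> {..<r}" "j \<in> {r..<n}" for i j
    using that phase[of "[0..<r][i := j]"] normal_form_minor1[OF N, of i j]
      normal_form_minor1[OF N', of i j] N(2)
    by (simp add: x_def tuples_update upt_in_tuples)
  have x0': "N' $$ (i, j) \<noteq> 0" if "i \<in> {..<r}" "j \<in> {r..<n}" for i j
    using sgn_entry[OF that] x0[OF that] by (metis sgn_zero_iff)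
  have t_pos: "0 < t i j" if "i \<in> {..<r}" "j \<in> {r..<n}" for i j
    using x0[OF that] x0'[OF that] by (simp add: t_def)
  have entry: "N' $$ (i, j) = of_real (t i j) * x i j" if "i \<in> {..<r}" "j \<in> {r..<n}" for i j
    using sgn_entry[OF that] x0[OF that] x0'[OF that]
    by (simp add: t_def sgn_eq field_simps)
  have full: "cross x i k j l \<in> \<real> \<or> cross t i k j l \<in> {1}"
    if ik: "i \<in> {..<r}" "k \<in> {..<r}" and jl: "j \<in> {r..<n}" "l \<in> {r..<n}" for i k j l
  proof (cases "i = k \<or> j = l")
    case True
    then show ?thesis using t_pos[OF ik(1) jl(1)] t_pos[OF ik(1) jl(2)] t_pos[OF ik(2) jl(1)]
      by (auto simp: cross_def)
  next
    case False
    \<comment> \<open>\<open>a / b\<close> is the cross ratio of \<open>x\<close>, and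
      \<open>a - b\<close> is a 2 x 2 minor of \<open>N\<close>. In the same minor of
      \<open>N'\<close> the two products carry the positive factors \<open>t i j * t k l\<close> and
      \<open>t i l * t k j\<close>, and the phase is the same.\<close>
    define a where "a = x i j * x k l"
    define b where "b = x i l * x k j"
    have "[0..<r][i := j, k := l] \<in> tuples r n"
      using jl N(2) by (simp add: tuples_update upt_in_tuples)
    from phase[OF this]
    have "sgn (a - b) = sgn (of_real (t i j * t k l) * a - of_real (t i l * t k j) * b)"
      using normal_form_minor2[OF N, of i k j l] normal_form_minor2[OF N', of i k j l]
        x0[OF ik(1) jl(1)] x0'[OF ik(1) jl(1)] ik jl False entry
      by (simp add: a_def b_def x_def mult_ac)
    moreover have "b \<noteq> 0" using x0 ik jl by (simp add: b_def)
    ultimately have "a / b \<in> \<real> \<or> t i j * t k l = t i l * t k j"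
      using phase_rigidity[of b a "t i j * t k l" "t i l * t k j"] by blast
    then show ?thesis
      using t_pos[OF ik(1) jl(2)] t_pos[OF ik(2) jl(1)] by (auto simp: cross_def a_def b_def)
  qed
  have t0: "t i j \<noteq> 0" if "i \<in> {..<r}" "j \<in> {r..<n}" for i j
    using t_pos[OF that] by simp
  have cross_t: "cross t i k j l = 1"
    if "i \<in> {..<r}" "k \<in> {..<r}" "j \<in> {r..<n}" "l \<in> {r..<n}" for i k j l
    using cross_dichotomy[of \<real> "{..<r}" "{r..<n}" x "{1}" t, OF mult_subgroup_Reals x0
        mult_subgroup_one t0 full] nonreal that
    unfolding x_def by blast
  define p where "p = (\<lambda>i. t i j0)"
  \<comment> \<open>On the first \<open>r\<close> columns the factor undoes \<open>p\<close>, so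
    that the identity block is preserved.\<close>
  define d where "d = (\<lambda>j. if j < r then 1 / p j else t i0 j / t i0 j0)"
  have p_pos: "0 < p i" if "i < r" for i
    using that t_pos nonreal by (simp add: p_def)
  have "0 < d j" if "j < n" for j
    using that t_pos nonreal by (auto simp: d_def p_def)
  moreover have "N' = mat_diag r (\<lambda>i. of_real (p i)) * (N * mat_diag n (\<lambda>j. of_real (d j)))"
  proof (rule diag_mult_diagI[OF N'(1) N(1)])
    fix i j assume ij: "i < r" "j < n"
    show "N' $$ (i, j) = of_real (p i) * N $$ (i, j) * of_real (d j)"
    proof (cases "j < r")
      case True
      then show ?thesis
        using ij p_pos[of j] by (auto simp: d_def normal_form_entry[OF N] normal_form_entry[OF N'])
    next
      case False
      have "t i j = t i j0 * cross t i i0 j j0 * (t i0 j / t i0 j0)"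
        by (rule cross_factor) (use ij False nonreal t0 in auto)
      also have "\<dots> = p i * d j"
        using False ij nonreal cross_t by (simp add: p_def d_def)
      finally show ?thesis
        using entry[of i j] ij False by (simp add: x_def)
    qed
  qed
  ultimately show ?thesis using that p_pos by blast
qed

text \<open>Replacing the entries of \<open>X\<close> by their cross ratios with base row 0 and base
  column \<open>r\<close> gives a real matrix \<open>W\<close>; \<open>cross_factor\<close> recovers
  \<open>N\<close> from it by scaling rows and columns.\<close>

lemma normal_form_real_cross:
  fixes N :: "complex mat"
  assumes N: "N \<in> carrier_mat r n" "r \<le> n" "select_cols r N [0..<r] = 1\<^sub>m r"
    and uniform: "\<And>xs. xs \<in> tuples r n \<Longrightarrow> distinct xs \<Longrightarrow> minor r N xs \<noteq> 0"
    and real: "\<And>i k j l. i < r \<Longrightarrow> k < r \<Longrightarrow> j \<in> {r..<n} \<Longrightarrow> l \<in> {r..<n} \<Longrightarrow>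
      cross (\<lambda>i j. N $$ (i, j)) i k j l \<in> \<real>"
  obtains W p d where "W \<in> carrier_mat r n" "\<And>i j. i < r \<Longrightarrow> j < n \<Longrightarrow> W $$ (i, j) \<in> \<real>"
    "\<And>i. i < r \<Longrightarrow> p i \<noteq> 0" "\<And>j. j < n \<Longrightarrow> d j \<noteq> 0"
    "N = mat_diag r p * (W * mat_diag n d)"
proof (cases "0 < r \<and> r < n")
  \<comment> \<open>The base row and base column do not both exist. Here \<open>N\<close> is already
    real: it has no rows, or it is the identity.\<close>
  case False
  then have "N $$ (i, j) \<in> \<real>" if "i < r" "j < n" for i j
    using that N(2) by (simp add: normal_form_entry[OF N])
  moreover have "N = mat_diag r (\<lambda>_. 1) * (N * mat_diag n (\<lambda>_. 1))"
    using N by simp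
  ultimately show ?thesis using that[of N "\<lambda>_. 1" "\<lambda>_. 1"] N(1) by simp
next
  case True
  define x where "x = (\<lambda>i j. N $$ (i, j))"
  define W where "W = Matrix.mat r n (\<lambda>(i, j). if j < r then N $$ (i, j) else cross x i 0 j r)"
  define p where "p = (\<lambda>i. x i r)"
  define d where "d = (\<lambda>j. if j < r then 1 / p j else x 0 j / x 0 r)"
  have x0: "x i j \<noteq> 0" if "i < r" "r \<le> j" "j < n" for i j
    using that normal_form_nonzero[OF N uniform, of i j] by (simp add: x_def)
  have W: "W \<in> carrier_mat r n" by (simp add: W_def)
  show ?thesis
  proof (rule that[OF W])
    show "W $$ (i, j) \<in> \<real>" if "i < r" "j < n" for i j
      using that real[of i 0 j r] True by (auto simp: W_def x_def normal_form_entry[OF N])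
    show p0: "p i \<noteq> 0" if "i < r" for i using that x0 True by (simp add: p_def)
    show "d j \<noteq> 0" if "j < n" for j
      using that x0 True p0 by (auto simp: d_def)
    show "N = mat_diag r p * (W * mat_diag n d)"
    proof (rule diag_mult_diagI[OF N(1) W])
      fix i j assume ij: "i < r" "j < n"
      show "N $$ (i, j) = p i * W $$ (i, j) * d j"
      proof (cases "j < r")
        case True
        then show ?thesis using ij p0 by (auto simp: W_def d_def normal_form_entry[OF N])
      next
        case False
        then have "x i j = x i r * cross x i 0 j r * (x 0 j / x 0 r)"
          using ij True by (intro cross_factor x0) auto
        then show ?thesis using ij False by (simp add: W_def d_def p_def x_def)
      qed
    qed
  qed
qed

subsection \<open>Realizations\<close>

lemma sgn_prod:
  fixes f :: "'a \<Rightarrow> complex"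
  shows "sgn (\<Prod>i\<in>I. f i) = (\<Prod>i\<in>I. sgn (f i))"
  by (induction I rule: infinite_finite_induct) (simp_all add: sgn_mult)

lemma cnj_sgn_mult_sgn: "z \<noteq> 0 \<Longrightarrow> cnj (sgn z) * sgn z = 1"
  using complex_norm_square[of "sgn z"] by (simp add: norm_sgn mult.commute)

lemma sgn_Reals:
  assumes "z \<in> \<real>"
  shows "sgn z \<in> {-1, 0, 1 :: complex}"
proof -
  from assms obtain x :: real where "z = of_real x" by (auto elim: Reals_cases)
  then show ?thesis by (auto simp: sgn_of_real sgn_if)
qed

lemma phirotope_of_mat_eq_minor:
  "xs \<in> tuples r n \<Longrightarrow> phirotope_of_mat r n A xs = sgn (minor r A xs)"
  by (simp add: phirotope_of_mat_def minor_def select_cols_def)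

text \<open>Swapping two equal entries leaves the tuple unchanged, so the value equals its own
  negative.\<close>

lemma phirotope_distinct:
  assumes "phirotope r n \<phi>" "xs \<in> tuples r n" "\<phi> xs \<noteq> 0"
  shows "distinct xs"
proof (rule ccontr)
  assume "\<not> distinct xs"
  then obtain i j where ij: "i < r" "j < r" "i \<noteq> j" "xs ! i = xs ! j"
    using length_tuples[OF assms(2)] by (auto simp: distinct_conv_nth)
  then have "xs[i := xs ! j, j := xs ! i] = xs"
    by (metis list_update_id)
  moreover have "alternating r n \<phi>" using assms(1) by (simp add: phirotope_def)
  ultimately have "\<phi> xs = - \<phi> xs"
    using assms(2) ij(1-3) unfolding alternating_def by metis
  then show False using assms(3) by simp
qed

lemma phirotope_rank_le:
  assumes "phirotope r n \<phi>"
  shows "r \<le> n"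
proof -
  obtain xs where xs: "xs \<in> tuples r n" "\<phi> xs \<noteq> 0"
    using assms by (auto simp: phirotope_def)
  then have "distinct xs" by (rule phirotope_distinct[OF assms])
  then have "r = card (set xs)"
    using xs(1) by (simp add: distinct_card tuples_def)
  also have "\<dots> \<le> card {..<n}"
    using xs(1) by (intro card_mono) (auto simp: tuples_def)
  finally show ?thesis by simp
qed

lemma phased_matroid_scale:
  assumes "phased_matroid r n M" "\<phi> \<in> M" "\<beta> \<in> S1"
  shows "(\<lambda>xs\<in>tuples r n. \<beta> * \<phi> xs) \<in> M"
proof -
  obtain \<psi> \<alpha> where M: "M = {(\<lambda>xs\<in>tuples r n. \<alpha> * \<psi> xs) | \<alpha>. \<alpha> \<in> S1}"
    and \<alpha>: "\<alpha> \<in> S1" "\<phi> = (\<lambda>xs\<in>tuples r n. \<alpha> * \<psi> xs)"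
    using assms(1,2) by (auto simp: phased_matroid_def)
  have "(\<lambda>xs\<in>tuples r n. \<beta> * \<phi> xs) = (\<lambda>xs\<in>tuples r n. (\<beta> * \<alpha>) * \<psi> xs)"
    by (auto simp: \<alpha>(2) restrict_def fun_eq_iff)
  moreover have "\<beta> * \<alpha> \<in> S1" using assms(3) \<alpha>(1) by (simp add: norm_mult)
  ultimately show ?thesis unfolding M by blast
qed

text \<open>The phase of a minor of \<open>A\<close> is the phase of \<open>det P\<close>, times the
  phases of the column factors, times the sign of a real minor of \<open>W\<close>. The scalar
  \<beta> cancels the first and the rephasing \<rho> the second, leaving only signs.\<close>

lemma essentially_oriented_if_real_factor:
  assumes M: "phased_matroid r n M" and A: "A \<in> realizations r n M"
    and P: "P \<in> carrier_mat r r" "Determinant.det P \<noteq> 0"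
    and W: "W \<in> carrier_mat r n" "\<And>i j. i < r \<Longrightarrow> j < n \<Longrightarrow> W $$ (i, j) \<in> \<real>"
    and d: "\<And>j. j < n \<Longrightarrow> d j \<noteq> 0" and eq: "A = P * (W * mat_diag n d)"
  shows "essentially_oriented r n M"
proof -
  define \<beta> where "\<beta> = cnj (sgn (Determinant.det P))"
  define \<phi> where "\<phi> = (\<lambda>xs\<in>tuples r n. \<beta> * phirotope_of_mat r n A xs)"
  define \<rho> where "\<rho> = (\<lambda>j. cnj (sgn (d j)))"
  have "\<beta> \<in> S1" using P by (simp add: \<beta>_def norm_sgn)
  then have \<phi>: "\<phi> \<in> M"
    unfolding \<phi>_def using phased_matroid_scale[OF M] A by (simp add: realizations_def)
  have \<rho>: "\<rho> \<in> {..<n} \<rightarrow> S1" using d by (simp add: \<rho>_def norm_sgn)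
  have WD: "W * mat_diag n d \<in> carrier_mat r n"
    using W(1) by (simp add: mult_carrier_mat[where n = n])
  have "rephasing r n \<rho> \<phi> xs \<in> {-1, 0, 1}" if xs: "xs \<in> tuples r n" for xs
  proof -
    have "rephasing r n \<rho> \<phi> xs = (\<Prod>i<r. \<rho> (xs ! i)) * (\<beta> * sgn (Determinant.det P *
        (minor r W xs * (\<Prod>i<r. d (xs ! i)))))"
      using xs by (simp add: rephasing_def \<phi>_def phirotope_of_mat_eq_minor eq
          minor_mult[OF P(1) WD] minor_scale_cols[OF W(1)])
    also have "\<dots> = (\<Prod>i<r. cnj (sgn (d (xs ! i))) * sgn (d (xs ! i))) *
        (cnj (sgn (Determinant.det P)) * sgn (Determinant.det P)) * sgn (minor r W xs)"
      by (simp add: sgn_mult sgn_prod prod.distrib \<beta>_def \<rho>_def)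
    also have "\<dots> = sgn (minor r W xs)"
      using P(2) d tuples_nth[OF xs] by (simp add: cnj_sgn_mult_sgn)
    finally show ?thesis
      using sgn_Reals[OF minor_Reals[OF W(1) xs W(2)]] by simp
  qed
  then show ?thesis
    unfolding essentially_oriented_def using \<phi> \<rho> by blast
qed

text \<open>Both phirotopes are unit multiples of one \<phi>, and \<gamma> is the quotient of the
  two units.\<close>

lemma realizations_phase:
  assumes "phased_matroid r n M" "A \<in> realizations r n M" "B \<in> realizations r n M"
  obtains \<gamma> where "\<gamma> \<noteq> 0"
    "\<And>xs. xs \<in> tuples r n \<Longrightarrow> sgn (minor r B xs) = \<gamma> * sgn (minor r A xs)"
proof -
  obtain \<phi> where M: "M = {(\<lambda>xs\<in>tuples r n. \<alpha> * \<phi> xs) | \<alpha>. \<alpha> \<in> S1}"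
    using assms(1) by (auto simp: phased_matroid_def)
  obtain \<alpha> where \<alpha>: "\<alpha> \<in> S1" "phirotope_of_mat r n A = (\<lambda>xs\<in>tuples r n. \<alpha> * \<phi> xs)"
    using assms(2) M by (auto simp: realizations_def)
  obtain \<beta> where \<beta>: "\<beta> \<in> S1" "phirotope_of_mat r n B = (\<lambda>xs\<in>tuples r n. \<beta> * \<phi> xs)"
    using assms(3) M by (auto simp: realizations_def)
  have nz: "\<alpha> \<noteq> 0" "\<beta> \<noteq> 0" using \<alpha>(1) \<beta>(1) by auto
  show ?thesis
  proof (rule that)
    show "\<beta> / \<alpha> \<noteq> 0" using nz by simp
    fix xs assume xs: "xs \<in> tuples r n"
    then have "sgn (minor r A xs) = \<alpha> * \<phi> xs" "sgn (minor r B xs) = \<beta> * \<phi> xs"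
      using \<alpha>(2) \<beta>(2) phirotope_of_mat_eq_minor[OF xs] by (metis restrict_apply')+
    then show "sgn (minor r B xs) = \<beta> / \<alpha> * sgn (minor r A xs)"
      using nz by simp
  qed
qed

lemma realization_minor_nonzero:
  assumes "uniform_matroid r n M" "A \<in> realizations r n M" "xs \<in> tuples r n" "distinct xs"
  shows "minor r A xs \<noteq> 0"
proof -
  have "phirotope_of_mat r n A xs \<noteq> 0"
    using assms by (auto simp: uniform_matroid_def realizations_def)
  then show ?thesis using phirotope_of_mat_eq_minor[OF assms(3), of A] by auto
qed

lemma realizations_scale_cols:
  fixes d :: "nat \<Rightarrow> real"
  assumes "A \<in> realizations r n M" "\<And>j. j < n \<Longrightarrow> 0 < d j"
  shows "A * mat_diag n (\<lambda>j. of_real (d j)) \<in> realizations r n M"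
proof -
  have A: "A \<in> carrier_mat r n" using assms(1) by (simp add: realizations_def)
  have "phirotope_of_mat r n (A * mat_diag n (\<lambda>j. of_real (d j))) = phirotope_of_mat r n A"
  proof
    fix xs
    show "phirotope_of_mat r n (A * mat_diag n (\<lambda>j. of_real (d j))) xs = phirotope_of_mat r n A xs"
    proof (cases "xs \<in> tuples r n")
      case True
      have "(\<Prod>i<r. sgn (complex_of_real (d (xs ! i)))) = 1"
        using assms(2) tuples_nth[OF True] by (simp add: sgn_of_real)
      then show ?thesis
        using True by (simp add: phirotope_of_mat_eq_minor minor_scale_cols[OF A] sgn_mult sgn_prod)
    qed (simp add: phirotope_of_mat_def)
  qed
  moreover have "A * mat_diag n (\<lambda>j. of_real (d j)) \<in> carrier_mat r n"
    using A by (simp add: mult_carrier_mat[where n = n])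
  ultimately show ?thesis using assms(1) by (simp add: realizations_def)
qed

text \<open>Both realizations are reduced to normal forms, which differ by positive row and column
  factors. The row factors are absorbed into \<open>P\<close>. The bound \<open>r < n\<close> comes
  along because a nonreal cross ratio needs a column beyond the first \<open>r\<close>.\<close>

lemma realization_rigidity:
  assumes M: "phased_matroid r n M" and unif: "uniform_matroid r n M"
    and nor: "\<not> essentially_oriented r n M"
    and A: "A \<in> realizations r n M" and B: "B \<in> realizations r n M"
  obtains P and d :: "nat \<Rightarrow> real" where "r < n" "P \<in> carrier_mat r r" "Determinant.det P \<noteq> 0"
    "\<And>j. j < n \<Longrightarrow> 0 < d j" "B = P * (A * mat_diag n (\<lambda>j. of_real (d j)))"
proof -
  have rn: "r \<le> n" using M phirotope_rank_le by (auto simp: phased_matroid_def)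
  have carr: "A \<in> carrier_mat r n" "B \<in> carrier_mat r n"
    using A B by (auto simp: realizations_def)
  note up = upt_in_tuples[OF rn]
  have "minor r A [0..<r] \<noteq> 0" "minor r B [0..<r] \<noteq> 0"
    using realization_minor_nonzero[OF unif _ up] A B by auto
  from normal_form[OF carr(1) rn this(1)] normal_form[OF carr(2) rn this(2)]
  obtain P N Q N' where P: "P \<in> carrier_mat r r" "Determinant.det P \<noteq> 0"
    and N: "N \<in> carrier_mat r n" "select_cols r N [0..<r] = 1\<^sub>m r" and AN: "A = P * N"
    and Q: "Q \<in> carrier_mat r r" "Determinant.det Q \<noteq> 0"
    and N': "N' \<in> carrier_mat r n" "select_cols r N' [0..<r] = 1\<^sub>m r" and BN: "B = Q * N'"
    by metis
  have uniform: "minor r N xs \<noteq> 0" if "xs \<in> tuples r n" "distinct xs" for xs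
    using realization_minor_nonzero[OF unif A that] minor_mult[OF P(1) N(1) that(1)]
    by (simp add: AN)
  obtain \<gamma> where \<gamma>: "\<gamma> \<noteq> 0"
    "\<And>xs. xs \<in> tuples r n \<Longrightarrow> sgn (minor r B xs) = \<gamma> * sgn (minor r A xs)"
    using realizations_phase[OF M A B] by blast
  define \<delta> where "\<delta> = \<gamma> * sgn (Determinant.det P) / sgn (Determinant.det Q)"
  have ph\<delta>: "sgn (minor r N' xs) = \<delta> * sgn (minor r N xs)" if "xs \<in> tuples r n" for xs
    using \<gamma>(2)[OF that] Q(2) unfolding AN BN minor_mult[OF P(1) N(1) that] minor_mult[OF Q(1) N'(1) that]
    by (simp add: sgn_mult \<delta>_def sgn_zero_iff field_simps)
  \<comment> \<open>On the first \<open>r\<close> columns both normal forms have minor 1, which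
    fixes the unit factor.\<close>
  from ph\<delta>[OF up] have "\<delta> = 1" by (simp add: minor_def N N')
  then have phase: "sgn (minor r N' xs) = sgn (minor r N xs)" if "xs \<in> tuples r n" for xs
    using ph\<delta>[OF that] by simp
  \<comment> \<open>This is where the matroid not being essentially oriented enters: if all cross
    ratios were real, \<open>N\<close> and hence \<open>A\<close> would be real up to
    \<open>GL(r)\<close> and column scaling.\<close>
  have "\<exists>i<r. \<exists>k<r. \<exists>j\<in>{r..<n}. \<exists>l\<in>{r..<n}. cross (\<lambda>i j. N $$ (i, j)) i k j l \<notin> \<real>"
  proof (rule ccontr)
    assume "\<not> ?thesis"
    then have real: "cross (\<lambda>i j. N $$ (i, j)) i k j l \<in> \<real>"
      if "i < r" "k < r" "j \<in> {r..<n}" "l \<in> {r..<n}" for i k j l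
      using that by blast
    obtain W p d where W: "W \<in> carrier_mat r n" "\<And>i j. i < r \<Longrightarrow> j < n \<Longrightarrow> W $$ (i, j) \<in> \<real>"
      and p: "\<And>i. i < r \<Longrightarrow> p i \<noteq> 0" and d: "\<And>j. j < n \<Longrightarrow> d j \<noteq> 0"
      and NW: "N = mat_diag r p * (W * mat_diag n d)"
      using normal_form_real_cross[OF N(1) rn N(2) uniform real] by blast
    have "W * mat_diag n d \<in> carrier_mat r n"
      using W(1) by (simp add: mult_carrier_mat[where n = n])
    then have eq: "A = (P * mat_diag r p) * (W * mat_diag n d)"
      unfolding AN NW using P(1) by (simp add: assoc_mult_mat[of P r r "mat_diag r p" r _ n])
    have det: "Determinant.det (P * mat_diag r p) \<noteq> 0"
      using P p by (simp add: Determinant.det_mult[OF P(1) mat_diag_dim] det_mat_diag)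
    have "P * mat_diag r p \<in> carrier_mat r r"
      using P(1) by (simp add: mult_carrier_mat[where n = r])
    from essentially_oriented_if_real_factor[OF M A this det W d eq] nor show False by simp
  qed
  then obtain i k j l where nonreal: "i < r" "k < r" "j \<in> {r..<n}" "l \<in> {r..<n}"
    "cross (\<lambda>i j. N $$ (i, j)) i k j l \<notin> \<real>" by blast
  obtain p d :: "nat \<Rightarrow> real" where p: "\<And>i. i < r \<Longrightarrow> 0 < p i" and d: "\<And>j. j < n \<Longrightarrow> 0 < d j"
    and N'N: "N' = mat_diag r (\<lambda>i. of_real (p i)) * (N * mat_diag n (\<lambda>j. of_real (d j)))"
    using normal_form_rigidity[OF N(1) rn N(2) N' uniform phase nonreal] by blast
  define E where "E = mat_diag n (\<lambda>j. complex_of_real (d j))"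
  define D where "D = mat_diag r (\<lambda>i. complex_of_real (p i))"
  \<comment> \<open>\<open>R\<close> is the inverse of \<open>P\<close>, so \<open>N = R * A\<close>
    and \<open>B = Q * D * N * E = (Q * D * R) * (A * E)\<close>.\<close>
  obtain R where R: "R \<in> carrier_mat r r" "P * R = 1\<^sub>m r" "R * P = 1\<^sub>m r"
    using P invertible_mat_iff_det[OF P(1)] invertible_matE by metis
  have E: "E \<in> carrier_mat n n" and D: "D \<in> carrier_mat r r" by (simp_all add: E_def D_def)
  have NE: "N * E \<in> carrier_mat r n" using N E by simp
  have "R * (A * E) = N * E"
    unfolding AN using P R N NE E
    by (simp add: assoc_mult_mat[of P r r N n E n] flip: assoc_mult_mat[of R r r P r "N * E" n])
  moreover have "(Q * D * R) * (A * E) = Q * D * (R * (A * E))"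
    using Q D R carr E by (intro assoc_mult_mat[of _ r r _ r _ n]) auto
  moreover have "Q * D * (N * E) = Q * (D * (N * E))"
    using Q D NE by (intro assoc_mult_mat[of _ r r _ r _ n]) auto
  ultimately have "B = (Q * D * R) * (A * E)"
    using BN N'N by (simp add: E_def D_def)
  moreover have "Q * D * R \<in> carrier_mat r r" using Q D R by simp
  moreover have "Determinant.det (Q * D * R) \<noteq> 0"
  proof -
    have "Determinant.det P * Determinant.det R = 1"
      using Determinant.det_mult[OF P(1) R(1)] R(2) by simp
    moreover have "Determinant.det D \<noteq> 0"
      using p by (simp add: D_def det_mat_diag order.strict_implies_not_eq[symmetric])
    moreover have "Determinant.det (Q * D * R) = Determinant.det Q * Determinant.det D * Determinant.det R"
      using Q D R by (simp add: Determinant.det_mult[of _ r])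
    ultimately show ?thesis using Q(2) by auto
  qed
  moreover have "r < n" using nonreal by auto
  ultimately show ?thesis using that d unfolding E_def by blast
qed

subsection \<open>The realization space\<close>

text \<open>\<open>F\<close> is constant on classes and descends to the quotient by its universal
  property. \<open>G\<close> is a continuous section of \<open>F\<close>, and its composition with
  the projection is the inverse.\<close>

lemma homeomorphic_space_quotient_topology:
  assumes F: "continuous_map X Y F" and G: "continuous_map Y X G"
    and FG: "\<And>y. y \<in> topspace Y \<Longrightarrow> F (G y) = y"
    and R: "equiv (topspace X) R" and inv: "\<And>x x'. (x, x') \<in> R \<Longrightarrow> F x = F x'"
    and GF: "\<And>x. x \<in> topspace X \<Longrightarrow> (x, G (F x)) \<in> R"
  shows "quotient_topology X R homeomorphic_space Y"
proof -
  define q where "q = (\<lambda>x. R `` {x})"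
  have q: "quotient_map X (quotient_topology X R) q"
    unfolding q_def by (rule quotient_map_quotient_topology)
  have lift: "F x = F x'" if "x \<in> topspace X" "x' \<in> topspace X" "q x = q x'" for x x'
    using that eq_equiv_class_iff[OF R] inv by (simp add: q_def)
  obtain F' where F': "continuous_map (quotient_topology X R) Y F'"
    "F' ` topspace (quotient_topology X R) = F ` topspace X"
    "\<And>x. x \<in> topspace X \<Longrightarrow> F' (q x) = F x"
    by (rule quotient_map_lift_exists[OF q F lift]) (assumption | rule that)+
  have Gtop: "G y \<in> topspace X" if "y \<in> topspace Y" for y
    using G that by (auto simp: continuous_map_def)
  have "homeomorphic_maps (quotient_topology X R) Y F' (q \<circ> G)"
    unfolding homeomorphic_maps_def
  proof (intro conjI ballI)
    show "continuous_map Y (quotient_topology X R) (q \<circ> G)"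
      by (rule continuous_map_compose[OF G quotient_imp_continuous_map[OF q]])
    fix u assume "u \<in> topspace (quotient_topology X R)"
    then obtain x where x: "x \<in> topspace X" "u = q x"
      using quotient_imp_surjective_map[OF q] by auto
    have "q x = q (G (F x))"
      unfolding q_def using equiv_class_eq[OF R GF[OF x(1)]] .
    then show "(q \<circ> G) (F' u) = u" using F'(3)[OF x(1)] x(2) by (metis comp_apply)
  next
    fix y assume "y \<in> topspace Y"
    then show "F' ((q \<circ> G) y) = y" using F'(3) FG Gtop by simp
  qed (rule F'(1))
  then show ?thesis by (auto simp: homeomorphic_space_def)
qed

section \<open>Continuity of matrix entries and minors\<close>

lemma continuous_map_mat_entry:
  assumes "i < r" "j < n"
  shows "continuous_map (mat_topology r n) euclidean (\<lambda>A. A $$ (i, j))"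
proof -
  have "continuous_map (mat_topology r n) euclidean
      ((\<lambda>f. f (i, j)) \<circ> (\<lambda>A. \<lambda>ij\<in>{..<r} \<times> {..<n}. A $$ ij))"
    unfolding mat_topology_def
    by (intro continuous_map_pullback continuous_map_product_projection) (use assms in auto)
  then show ?thesis
    by (rule continuous_map_eq) (use assms in auto)
qed

lemma continuous_map_into_mat_topology:
  assumes "\<And>x. x \<in> topspace X \<Longrightarrow> f x \<in> carrier_mat r n"
    and "\<And>i j. i < r \<Longrightarrow> j < n \<Longrightarrow> continuous_map X euclidean (\<lambda>x. f x $$ (i, j))"
  shows "continuous_map X (mat_topology r n) f"
  unfolding mat_topology_def
  by (rule continuous_map_pullback') (use assms in \<open>auto simp: continuous_map_componentwise\<close>)

text \<open>By the Leibniz formula a minor is a polynomial in the entries.\<close>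

lemma continuous_map_minor:
  assumes xs: "xs \<in> tuples r n"
  shows "continuous_map (mat_topology r n) euclidean (\<lambda>A. minor r A xs)"
proof -
  have "continuous_map (mat_topology r n) euclidean
      (\<lambda>A. \<Sum>p\<in>{p. p permutes {0..<r}}. signof p * (\<Prod>i = 0..<r. A $$ (i, xs ! p i)))"
  proof (rule continuous_map_sum)
    show "finite {p. p permutes {0..<r}}" by (simp add: finite_permutations)
    fix p :: "nat \<Rightarrow> nat" assume "p \<in> {p. p permutes {0..<r}}"
    then have "xs ! p i < n" if "i < r" for i
      using that permutes_in_image[of p "{0..<r}" i] tuples_nth[OF xs, of "p i"] by auto
    then have "continuous_map (mat_topology r n) euclidean (\<lambda>A. A $$ (i, xs ! p i))"
      if "i \<in> {0..<r}" for i
      using that by (intro continuous_map_mat_entry) auto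
    then show "continuous_map (mat_topology r n) euclidean
        (\<lambda>A. signof p * (\<Prod>i = 0..<r. A $$ (i, xs ! p i)))"
      by (auto simp: continuous_map_atin intro!: tendsto_mult tendsto_prod)
  qed
  then show ?thesis
  proof (rule continuous_map_eq)
    fix A assume "A \<in> topspace (mat_topology r n)"
    then have A: "A \<in> carrier_mat r n" by (simp add: topspace_mat_topology)
    show "(\<Sum>p\<in>{p. p permutes {0..<r}}. signof p * (\<Prod>i = 0..<r. A $$ (i, xs ! p i))) = minor r A xs"
      unfolding minor_def det_def'[OF select_cols_carrier[OF xs]]
    proof (intro sum.cong refl, rule arg_cong[of _ _ "\<lambda>z. _ * z"], rule prod.cong[OF refl])
      fix p i assume "p \<in> {p. p permutes {0..<r}}" "i \<in> {0..<r}"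
      then have "p i < r" using permutes_in_image[of p "{0..<r}" i] by auto
      then show "A $$ (i, xs ! p i) = select_cols r A xs $$ (i, p i)"
        using select_cols_index[OF A xs] \<open>i \<in> {0..<r}\<close> by simp
    qed
  qed
qed

text \<open>Removing \<open>i\<close> and \<open>n - 1\<close> leaves \<open>n - 2\<close> columns,
  and \<open>r < n\<close> ensures that \<open>r - 1\<close> of them can be chosen for
  \<open>s\<close>.\<close>

lemma avoiding_tuple:
  assumes "0 < r" "r < n" "i < n - 1"
  obtains s where "i # s \<in> tuples r n" "distinct (i # s)"
    "(n - 1) # s \<in> tuples r n" "distinct ((n - 1) # s)"
proof -
  have "r - 1 \<le> card ({..<n - 1} - {i})" using assms by simp
  then obtain T where T: "T \<subseteq> {..<n - 1} - {i}" "card T = r - 1" "finite T"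
    by (rule obtain_subset_with_card_n)
  obtain s where s: "set s = T" "distinct s"
    using finite_distinct_list[OF T(3)] by blast
  moreover have "length s = r - 1" using s T(2) distinct_card by metis
  ultimately show ?thesis
    using that[of s] T(1) assms by (fastforce simp: tuples_def)
qed

text \<open>Apart from the minor of \<open>A\<close>, the bracket depends on \<open>P\<close> and
  \<open>s\<close> only. It therefore cancels when two minors with the same \<open>s\<close> are
  divided, and the factors of the two leading columns remain.\<close>

lemma minor_GL_scale_Cons:
  fixes d :: "nat \<Rightarrow> real" and A P :: "complex mat"
  assumes "A \<in> carrier_mat r n" "P \<in> carrier_mat r r" "i # s \<in> tuples r n"
    and "\<And>j. j < n \<Longrightarrow> 0 < d j"
  shows "cmod (minor r (P * (A * mat_diag n (\<lambda>j. of_real (d j)))) (i # s)) =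
    d i * (cmod (Determinant.det P) * (\<Prod>k<r - 1. d (s ! k)) * cmod (minor r A (i # s)))"
proof -
  have r: "r = Suc (r - 1)" using assms(3) by (auto simp: tuples_def)
  have AD: "A * mat_diag n (\<lambda>j. of_real (d j)) \<in> carrier_mat r n"
    using assms(1) by (simp add: mult_carrier_mat[where n = n])
  have "(\<Prod>k<r. d ((i # s) ! k)) = d i * (\<Prod>k<r - 1. d (s ! k))"
    by (subst r) (simp only: prod.lessThan_Suc_shift nth_Cons_0 nth_Cons_Suc)
  moreover have "cmod (\<Prod>k<r. of_real (d ((i # s) ! k))) = (\<Prod>k<r. d ((i # s) ! k))"
    using assms(4) tuples_nth[OF assms(3)]
    by (auto simp: prod_norm[symmetric] abs_of_pos intro!: prod.cong)
  ultimately show ?thesis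
    by (simp add: minor_mult[OF assms(2) AD assms(3)] minor_scale_cols[OF assms(1,3)] norm_mult mult_ac)
qed

lemma GL_relE:
  assumes "(A, B) \<in> GL_rel r S"
  obtains P where "A \<in> S" "B \<in> S" "P \<in> carrier_mat r r" "Determinant.det P \<noteq> 0" "B = P * A"
  using assms by (auto simp: GL_rel_def invertible_mat_iff_det)

theorem theorem3p3:
  fixes r n :: nat and M :: "(nat list \<Rightarrow> complex) set"
  assumes "phased_matroid r n M"
    and "uniform_matroid r n M"
    and "\<not> essentially_oriented r n M"
    and "realizable r n M"
  shows "realization_space r n M homeomorphic_space
    product_topology (\<lambda>_. top_of_set {0::real<..}) {..<n - 1}"
proof -
  note rigid = realization_rigidity[OF assms(1-3)]
  obtain A where A: "A \<in> realizations r n M"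
    using assms(4) by (auto simp: realizable_def)
  have rn: "r < n" using rigid[OF A A] by blast
  have r0: "0 < r" using assms(1) by (auto simp: phased_matroid_def phirotope_def)
  have carr: "B \<in> carrier_mat r n" if "B \<in> realizations r n M" for B
    using that by (simp add: realizations_def)
  note minor_nz = realization_minor_nonzero[OF assms(2)]
  define X where "X = subtopology (mat_topology r n) (realizations r n M)"
  define Y where "Y = product_topology (\<lambda>_. top_of_set {0::real<..}) {..<n - 1}"
  define R where "R = GL_rel r (realizations r n M)"
  have topX: "topspace X = realizations r n M"
    using carr by (auto simp: X_def topspace_mat_topology)
  have topY: "topspace Y = {..<n - 1} \<rightarrow>\<^sub>E {0<..}"
    by (simp add: Y_def)
  have "\<forall>i<n - 1. \<exists>s. i # s \<in> tuples r n \<and> distinct (i # s) \<and>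
      (n - 1) # s \<in> tuples r n \<and> distinct ((n - 1) # s)"
    using avoiding_tuple[OF r0 rn] by metis
  then obtain \<sigma> where \<sigma>: "i # \<sigma> i \<in> tuples r n" "distinct (i # \<sigma> i)"
      "(n - 1) # \<sigma> i \<in> tuples r n" "distinct ((n - 1) # \<sigma> i)" if "i < n - 1" for i
    by metis
  \<comment> \<open>The tuples \<open>i # \<sigma> i\<close> and \<open>(n - 1) # \<sigma> i\<close> share all columns but one, so for \<open>B = P A D\<close> the
    quotient of the two minors isolates the scaling factor of column \<open>i\<close> relative to the last.\<close>
  define F where "F = (\<lambda>B. \<lambda>i\<in>{..<n - 1}.
    (cmod (minor r B (i # \<sigma> i)) * cmod (minor r A ((n - 1) # \<sigma> i))) /
    (cmod (minor r B ((n - 1) # \<sigma> i)) * cmod (minor r A (i # \<sigma> i))))"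
  \<comment> \<open>A scalar common to all columns belongs to \<open>GL(r)\<close>, so the factor of
    the last column is normalized to 1. This is why \<open>n - 1\<close> coordinates remain.\<close>
  define d where "d = (\<lambda>(e :: nat \<Rightarrow> real) j. if j < n - 1 then e j else 1)"
  define G where "G = (\<lambda>e. A * mat_diag n (\<lambda>j. complex_of_real (d e j)))"
  have d_pos: "0 < d e j" if "e \<in> topspace Y" for e j
    using that by (auto simp: topY d_def)
  have G_real: "G e \<in> realizations r n M" if "e \<in> topspace Y" for e
    unfolding G_def by (rule realizations_scale_cols[OF A]) (rule d_pos[OF that])
  have F_eq: "F (P * (A * mat_diag n (\<lambda>j. of_real (c j)))) i = c i / c (n - 1)"
    if "P \<in> carrier_mat r r" "Determinant.det P \<noteq> 0" "\<And>j. j < n \<Longrightarrow> 0 < c j" "i < n - 1"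
    for P i and c :: "nat \<Rightarrow> real"
  proof -
    \<comment> \<open>The factor shared by both minors of the scaled matrix. It cancels in
      \<open>F\<close>, as do the minors of \<open>A\<close>, which occur crosswise.\<close>
    define u where "u = cmod (Determinant.det P) * (\<Prod>k<r - 1. c (\<sigma> i ! k))"
    have "0 < c (\<sigma> i ! k)" if "k < r - 1" for k
      using tuples_nth[OF \<sigma>(1)[OF \<open>i < n - 1\<close>], of "Suc k"] that \<open>\<And>j. j < n \<Longrightarrow> 0 < c j\<close> r0 by simp
    then have "u \<noteq> 0" using that(2) by (simp add: u_def prod_pos order.strict_implies_not_eq[symmetric])
    moreover have "minor r A (i # \<sigma> i) \<noteq> 0" "minor r A ((n - 1) # \<sigma> i) \<noteq> 0"
      using minor_nz[OF A] \<sigma>[OF that(4)] by blast+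
    moreover have "cmod (minor r (P * (A * mat_diag n (\<lambda>j. of_real (c j)))) (k # \<sigma> i)) =
        c k * (u * cmod (minor r A (k # \<sigma> i)))" if "k # \<sigma> i \<in> tuples r n" for k
      unfolding u_def using carr[OF A] \<open>P \<in> _\<close> that \<open>\<And>j. j < n \<Longrightarrow> 0 < c j\<close>
      by (rule minor_GL_scale_Cons)
    ultimately show ?thesis
      using \<sigma>(1,3)[OF that(4)] that(4) by (simp add: F_def)
  qed
  have "quotient_topology X R homeomorphic_space Y"
  proof (rule homeomorphic_space_quotient_topology)
    show "continuous_map X Y F"
      unfolding Y_def continuous_map_componentwise
    proof (intro conjI ballI)
      show "F ` topspace X \<subseteq> extensional {..<n - 1}" by (auto simp: F_def)
      fix i assume i: "i \<in> {..<n - 1}"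
      then have nz: "minor r B (i # \<sigma> i) \<noteq> 0" "minor r B ((n - 1) # \<sigma> i) \<noteq> 0"
        if "B \<in> realizations r n M" for B
        using minor_nz[OF that] \<sigma>[of i] by auto
      have "continuous_map X euclidean (\<lambda>B. minor r B xs)" if "xs \<in> tuples r n" for xs
        unfolding X_def by (rule continuous_map_from_subtopology[OF continuous_map_minor[OF that]])
      then have "continuous_map X euclidean (\<lambda>B.
          (cmod (minor r B (i # \<sigma> i)) * cmod (minor r A ((n - 1) # \<sigma> i))) /
          (cmod (minor r B ((n - 1) # \<sigma> i)) * cmod (minor r A (i # \<sigma> i))))"
        using i \<sigma>[of i] nz A
        by (intro continuous_map_real_divide continuous_map_real_mult continuous_map_norm
            continuous_map_canonical_const) (auto simp: topX)
      then show "continuous_map X (top_of_set {0<..}) (\<lambda>B. F B i)"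
        using i nz A by (auto simp: F_def continuous_map_in_subtopology topX)
    qed
    show "continuous_map Y X G"
      unfolding X_def
    proof (rule continuous_map_into_subtopology)
      show "G \<in> topspace Y \<rightarrow> realizations r n M" using G_real by auto
      show "continuous_map Y (mat_topology r n) G"
      proof (rule continuous_map_into_mat_topology)
        show "G e \<in> carrier_mat r n" if "e \<in> topspace Y" for e using carr[OF G_real[OF that]] .
        fix i j assume ij: "i < r" "j < n"
        have "continuous_map Y euclideanreal (\<lambda>e. e j)" if "j < n - 1"
          using continuous_map_product_projection[of j "{..<n - 1}" "\<lambda>_. top_of_set {0::real<..}"] that
          by (simp add: Y_def continuous_map_in_subtopology)
        then have "continuous_map Y euclideanreal (\<lambda>e. d e j)"
          by (cases "j < n - 1") (simp_all add: d_def)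
        then have "continuous_map Y euclidean (\<lambda>e. A $$ (i, j) * complex_of_real (d e j))"
          by (simp add: continuous_map_atin tendsto_mult tendsto_of_real)
        then show "continuous_map Y euclidean (\<lambda>e. G e $$ (i, j))"
          using ij by (simp add: G_def mat_diag_mult_right[OF carr[OF A]])
      qed
    qed
    show "F (G e) = e" if "e \<in> topspace Y" for e
    proof (rule extensionalityI[of _ "{..<n - 1}"])
      show "e \<in> extensional {..<n - 1}" using that by (simp add: topY PiE_iff)
      fix i assume "i \<in> {..<n - 1}"
      \<comment> \<open>The identity matrix is inserted to bring \<open>G e\<close> into the shape
        that \<open>F_eq\<close> speaks about.\<close>
      then have "F (1\<^sub>m r * G e) i = d e i / d e (n - 1)"
        unfolding G_def using d_pos[OF that] by (intro F_eq) auto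
      moreover have "1\<^sub>m r * G e = G e"
        using carr[OF G_real[OF that]] by simp
      ultimately show "F (G e) i = e i" using \<open>i \<in> _\<close> by (simp add: d_def)
    qed (simp add: F_def)
    show "equiv (topspace X) R"
      unfolding topX R_def using carr by (intro equiv_GL_rel) auto
    show "F B = F B'" if BB': "(B, B') \<in> R" for B B'
    proof -
      obtain P where P: "B \<in> realizations r n M" "P \<in> carrier_mat r r" "Determinant.det P \<noteq> 0"
        "B' = P * B"
        using BB' unfolding R_def by (rule GL_relE)
      show ?thesis
        \<comment> \<open>The determinant of \<open>P\<close> appears in numerator and denominator
          and cancels.\<close>
        using P(3) \<sigma> by (auto simp: F_def P(4) minor_mult[OF P(2) carr[OF P(1)]] norm_mult)
    qed
    show "(B, G (F B)) \<in> R" if "B \<in> topspace X" for B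
    proof -
      have B: "B \<in> realizations r n M" using that topX by simp
      obtain P and c :: "nat \<Rightarrow> real" where P: "P \<in> carrier_mat r r" "Determinant.det P \<noteq> 0"
        and c: "\<And>j. j < n \<Longrightarrow> 0 < c j" and BP: "B = P * (A * mat_diag n (\<lambda>j. of_real (c j)))"
        using rigid[OF A B] by blast
      \<comment> \<open>Dividing all factors by that of the last column gives the normalized factors
        \<open>d (F B)\<close>; the scalar \<open>b\<close> split off this way moves from the
        columns into \<open>P\<close>.\<close>
      define b where "b = c (n - 1)"
      have b: "0 < b" using c rn by (simp add: b_def)
      have FB: "F B i = c i / b" if "i < n - 1" for i
        unfolding BP b_def using P c that by (rule F_eq)
      have dF: "d (F B) j = c j / b" if "j < n" for j
      proof (cases "j < n - 1")
        case False
        then have "j = n - 1" using that by simp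
        then show ?thesis using b by (simp add: d_def b_def)
      qed (simp add: d_def FB)
      have GF: "G (F B) \<in> realizations r n M"
        unfolding G_def using c b by (intro realizations_scale_cols[OF A]) (simp add: dF)
      have "A * mat_diag n (\<lambda>j. of_real (c j)) = of_real b \<cdot>\<^sub>m G (F B)"
        using b carr[OF A]
        by (auto simp: G_def mat_diag_mult_right[OF carr[OF A]] dF intro!: eq_matI)
      then have "B = P * (of_real b \<cdot>\<^sub>m G (F B))" using BP by metis
      then have "B = (of_real b \<cdot>\<^sub>m P) * G (F B)"
        using mult_smult_assoc_mat[OF P(1) carr[OF GF]] mult_smult_distrib[OF P(1) carr[OF GF]]
        by metis
      moreover have "invertible_mat (of_real b \<cdot>\<^sub>m P)"
        using P b by (simp add: invertible_mat_iff_det[of _ r])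
      ultimately have "(G (F B), B) \<in> R"
        using B GF P(1) unfolding R_def GL_rel_def by (blast intro: smult_carrier_mat)
      moreover have "sym R"
        using equiv_GL_rel[of "realizations r n M" r n] carr by (auto simp: R_def equiv_def)
      ultimately show ?thesis by (meson symD)
    qed
  qed
  then show ?thesis
    by (simp add: realization_space_def X_def Y_def R_def)
qed

end
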